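(* Let $\mathbb{S}$ be a metric space. The following equalities hold for all $P,Q\in\mathbb{P}(\mathbb{S})$: (i) $\rho_{tv}(P,Q)=2\sup\{|P(C)-Q(C)|: C\text{ is closed in }\mathbb{S}\}=2\sup\{P(C)-Q(C): C\text{ is closed in }\mathbb{S}\}$; (ii) $\rho_{tv}(P,Q)=2\sup\{|P(\mathcal{O})-Q(\mathcal{O})|:\mathcal{O}\text{ is open in }\mathbb{S}\}=2\sup\{P(\mathcal{O})-Q(\mathcal{O}):\mathcal{O}\text{ is open in }\mathbb{S}\}$; (iii) $\rho_{tv}(P,Q)=\sup\left\{\int_{\mathbb{S}}f(s)P(ds)-\int_{\mathbb{S}}f(s)Q(ds): f:\mathbb{S}\to[-1,1]\text{ is continuous}\right\}$; (iv) $\rho_{tv}(P,Q)=\sup\left\{\left|\int_{\mathbb{S}}f(s)P(ds)-\int_{\mathbb{S}}f(s)Q(ds)\right|: f:\mathbb{S}\to[-1,1]\text{ is continuous}\right\}$.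
   Context: $\mathbb{P}(\mathbb{S})$ is the set of probability measures on $(\mathbb{S},\mathcal{B}(\mathbb{S}))$, where $\mathcal{B}(\mathbb{S})$ is the Borel $\sigma$-field of $\mathbb{S}$. The distance in the total variation is $$\rho_{tv}(P,Q):=\sup\left\{\left|\int_{\mathbb{S}}f(s)P(ds)-\int_{\mathbb{S}}f(s)Q(ds)\right|: f:\mathbb{S}\to[-1,1]\text{ is Borel-measurable}\right\}.$$ *)

theory Defs
  imports "HOL-Probability.Probability"
begin

(* Sup is the conditionally complete supremum of real. For probability measures P and Q
   the set below contains 0 (take f = 0) and is bounded above by 2, so this is the actual
   supremum. *)
definition rho_tv :: "'a::topological_space measure \<Rightarrow> 'a measure \<Rightarrow> real" where
  "rho_tv P Q = Sup {\<bar>(\<integral>s. f s \<partial>P) - (\<integral>s. f s \<partial>Q)\<bar> | f :: 'a \<Rightarrow> real.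
     f \<in> borel_measurable borel \<and> f \<in> UNIV \<rightarrow> {-1..1}}"

end

theory Submission
  imports Defs
begin

text \<open>
  All the suprema have the same upper bounds, and that is how they are compared: writing
  \<open>I f\<close> for the difference of the integrals of \<open>f\<close> and \<open>D A\<close> for the difference of the
  measures of \<open>A\<close>, the bounds \<open>I f \<le> 2 * d\<close> for continuous \<open>f\<close>, \<open>D C \<le> d\<close> for closed \<open>C\<close>,
  \<open>D A \<le> d\<close> for Borel \<open>A\<close>, and \<open>\<bar>I f\<bar> \<le> 2 * d\<close> for Borel \<open>f\<close> are equivalent, for every \<open>d\<close>.

  From continuous functions to closed sets: the indicator of a nonempty closed set \<open>C\<close> is the limit of
  the continuous functions \<open>max 0 (1 - n * infdist x C)\<close>, and dominated convergence applies
  (\<open>closed_bound_if_continuous_bound\<close>). From closed sets to Borel sets: a finite Borel measure on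
  a metric space is inner regular with respect to closed sets, so that replacing \<open>A\<close> by a closed
  \<open>C \<subseteq> A\<close> costs little mass under the first measure and can only lower the subtracted second one
  (\<open>borel_closed_open_approx\<close>, \<open>borel_bound_if_closed_bound\<close>). From Borel sets to Borel functions:
  a function with values in \<open>[0, 1]\<close> is, up to \<open>1 / n\<close>, the average of the indicators of \<open>n\<close> of its
  superlevel sets (\<open>integral_diff_le_if_borel_bound\<close>). The absolute value is free for functions
  because \<open>f\<close> may be replaced by \<open>- f\<close>. Open sets are complements of closed sets, and complementation
  changes the sign of \<open>D\<close>, that is, exchanges the two measures.
\<close>

section \<open>Closed inner and open outer regularity in metric spaces\<close>

text \<open>A nonempty closed set is the intersection of its open neighbourhoods of radius
  \<open>1 / (n + 1)\<close>, so continuity of the measure from above yields the outer approximation.\<close>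

lemma closed_outer_approx:
  fixes M :: "'a::metric_space measure"
  assumes "finite_measure M" and sets: "sets M = sets borel"
    and C: "closed C" and e: "(e::real) > 0"
  shows "\<exists>U. open U \<and> C \<subseteq> U \<and> measure M (U - C) < e"
proof (cases "C = {}")
  case True
  then show ?thesis using e by (intro exI[of _ "{}"]) auto
next
  case False
  interpret finite_measure M by fact
  define U where "U n = {x. infdist x C < 1 / real (Suc n)}" for n
  have opn: "open (U n)" for n
    unfolding U_def by (intro open_Collect_less continuous_intros)
  have sub: "C \<subseteq> U n" for n
    by (auto simp: U_def)
  have "decseq (\<lambda>n. U n - C)"
    by (auto simp: decseq_def U_def elim!: less_le_trans intro!: divide_left_mono)
  moreover have "range (\<lambda>n. U n - C) \<subseteq> sets M"
    using opn C by (auto simp: sets)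
  ultimately have "(\<lambda>n. measure M (U n - C)) \<longlonglongrightarrow> measure M (\<Inter>n. U n - C)"
    by (intro finite_Lim_measure_decseq)
  also have "(\<Inter>n. U n - C) = {}"
  proof safe
    fix x assume x: "x \<in> (\<Inter>n. U n - C)"
    then have "infdist x C > 0"
      using in_closed_iff_infdist_zero[OF C False, of x] infdist_nonneg[of x C] by auto
    then obtain n where "inverse (real (Suc n)) < infdist x C"
      using reals_Archimedean by blast
    moreover have "x \<in> U n" using x by blast
    ultimately show "x \<in> {}" by (auto simp: U_def field_simps)
  qed
  finally have "(\<lambda>n. measure M (U n - C)) \<longlonglongrightarrow> 0" by simp
  then have "\<forall>\<^sub>F n in sequentially. measure M (U n - C) < e"
    using e by (rule order_tendstoD)
  then obtain n where "measure M (U n - C) < e"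
    by (auto simp: eventually_sequentially)
  with opn sub show ?thesis by blast
qed

text \<open>The sets that can be squeezed between a closed and an open set of almost the same measure
  form a \<open>\<sigma>\<close>-algebra; carrying both sides along makes the property symmetric under complements.
  A countable union of closed sets need not be closed, so the inner set of a union is a long
  finite partial union.\<close>

lemma borel_closed_open_approx:
  fixes M :: "'a::metric_space measure"
  assumes "finite_measure M" and sets: "sets M = sets borel"
    and A: "A \<in> sets borel" and e: "(e::real) > 0"
  shows "\<exists>C U. closed C \<and> open U \<and> C \<subseteq> A \<and> A \<subseteq> U \<and> measure M (U - C) < e"
proof -
  interpret finite_measure M by fact
  have "A \<in> sigma_sets UNIV (Collect closed)"
    using A by (auto simp: borel_eq_closed)
  then show ?thesis using e
  proof (induction arbitrary: e rule: sigma_sets.induct)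
    case (Basic a)
    then show ?case
      using closed_outer_approx[OF assms(1) sets, of a e] by auto
  next
    case Empty
    then show ?case by (intro exI[of _ "{}"]) auto
  next
    case (Compl a)
    obtain C U where CU: "closed C" "open U" "C \<subseteq> a" "a \<subseteq> U" "measure M (U - C) < e"
      using Compl.IH[OF Compl.prems] by auto
    moreover have "- C - - U = U - C" by auto
    ultimately have "closed (- U) \<and> open (- C) \<and> - U \<subseteq> UNIV - a \<and> UNIV - a \<subseteq> - C \<and>
        measure M (- C - - U) < e"
      by (simp only: closed_Compl open_Compl) blast
    then show ?case by blast
  next
    case (Union a)
    \<comment> \<open>the tolerances sum to \<open>e / 2\<close>\<close>
    define t where "t i = e / 4 * (1 / 2) ^ i" for i :: nat
    have "t i > 0" for i using Union.prems by (simp add: t_def)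
    then have "\<forall>i. \<exists>C U. closed C \<and> open U \<and> C \<subseteq> a i \<and> a i \<subseteq> U \<and> measure M (U - C) < t i"
      using Union.IH by blast
    then obtain C U where CU: "\<And>i. closed (C i)" "\<And>i. open (U i)" "\<And>i. C i \<subseteq> a i"
        "\<And>i. a i \<subseteq> U i" "\<And>i. measure M (U i - C i) < t i"
      by metis
    have t_sums: "t sums (e / 2)"
      using sums_mult[OF geometric_sums[of "1 / 2 :: real"], of "e / 4"]
      unfolding t_def by simp
    have mC: "C i \<in> sets M" and mU: "U i \<in> sets M" for i
      using CU by (auto simp: sets)
    have summ: "summable (\<lambda>i. measure M (U i - C i))"
      using sums_summable[OF t_sums]
      by (rule summable_comparison_test'[where N=0]) (simp add: CU(5) less_imp_le)
    have "measure M (\<Union>i. U i - C i) \<le> (\<Sum>i. measure M (U i - C i))"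
      using mC mU summ by (intro finite_measure_subadditive_countably) auto
    also have "\<dots> \<le> (\<Sum>i. t i)"
      by (rule suminf_le[OF less_imp_le[OF CU(5)] summ sums_summable[OF t_sums]])
    also have "\<dots> = e / 2" using t_sums by (simp add: sums_iff)
    finally have outer: "measure M (\<Union>i. U i - C i) \<le> e / 2" .
    define R where "R n = (\<Union>i. C i) - (\<Union>i\<le>n. C i)" for n :: nat
    have mR: "R n \<in> sets M" for n
      unfolding R_def using mC by (intro sets.Diff sets.countable_UN sets.finite_UN) auto
    have "decseq R"
      unfolding decseq_def R_def by (auto intro: order_trans)
    then have "(\<lambda>n. measure M (R n)) \<longlonglongrightarrow> measure M (\<Inter>n. R n)"
      using mR by (intro finite_Lim_measure_decseq) auto
    also have "(\<Inter>n. R n) = {}" unfolding R_def by blast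
    finally have "(\<lambda>n. measure M (R n)) \<longlonglongrightarrow> 0" by simp
    then have "\<forall>\<^sub>F n in sequentially. measure M (R n) < e / 2"
      using Union.prems by (intro order_tendstoD(2)) auto
    then obtain n where n: "measure M (R n) < e / 2"
      by (auto simp: eventually_sequentially)
    have "measure M ((\<Union>i. U i) - (\<Union>i\<le>n. C i)) \<le> measure M ((\<Union>i. U i - C i) \<union> R n)"
      using mC mU mR unfolding R_def by (intro finite_measure_mono sets.Un sets.countable_UN) auto
    also have "\<dots> \<le> measure M (\<Union>i. U i - C i) + measure M (R n)"
      using mC mU mR by (intro measure_Un_le sets.countable_UN) auto
    also have "\<dots> < e" using outer n by simp
    finally have "measure M ((\<Union>i. U i) - (\<Union>i\<le>n. C i)) < e" .
    moreover have "closed (\<Union>i\<le>n. C i)" "open (\<Union>i. U i)" using CU by auto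
    moreover have "(\<Union>i\<le>n. C i) \<subseteq> (\<Union>i. a i)" "(\<Union>i. a i) \<subseteq> (\<Union>i. U i)"
      using CU(3,4) by blast+
    ultimately show ?case by blast
  qed
qed

section \<open>Transfer of bounds between sets and functions\<close>

lemma borel_bound_if_closed_bound:
  fixes P Q :: "'a::metric_space measure"
  assumes P: "finite_measure P" "sets P = sets borel"
    and Q: "finite_measure Q" "sets Q = sets borel"
    and bound: "\<And>C. closed C \<Longrightarrow> measure P C - measure Q C \<le> d"
    and A: "A \<in> sets borel"
  shows "measure P A - measure Q A \<le> d"
proof (rule field_le_epsilon)
  fix e :: real assume e: "e > 0"
  obtain C U where CU: "closed C" "open U" "C \<subseteq> A" "A \<subseteq> U" "measure P (U - C) < e"
    using borel_closed_open_approx[OF P A e] by auto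
  interpret P: finite_measure P by fact
  interpret Q: finite_measure Q by fact
  have "C \<in> sets P" "A \<in> sets P" using CU(1) A by (simp_all add: P(2))
  from P.finite_measure_Diff[OF this(2,1) CU(3)]
  have "measure P A = measure P C + measure P (A - C)" by linarith
  also have "measure P (A - C) \<le> measure P (U - C)"
    using CU(1,2,4) by (intro P.finite_measure_mono) (auto simp: P(2))
  finally have "measure P A \<le> measure P C + e" using CU(5) by simp
  moreover have "measure Q C \<le> measure Q A"
    using CU(3) A by (intro Q.finite_measure_mono) (auto simp: Q(2))
  ultimately show "measure P A - measure Q A \<le> d + e"
    using bound[OF CU(1)] by simp
qed

text \<open>Counting the levels \<open>1, \<dots>, n\<close> that a point \<open>y\<close> of \<open>[0, n]\<close> reaches gives its integer part.\<close>

lemma sum_levels_bounds: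
  fixes y :: real
  assumes "0 \<le> y" "y \<le> real n"
  shows "(\<Sum>k=1..n. if real k \<le> y then 1 else 0 :: real) \<le> y"
    and "y \<le> (\<Sum>k=1..n. if real k \<le> y then 1 else 0 :: real) + 1"
proof -
  have "{k \<in> {1..n}. real k \<le> y} = {1..nat \<lfloor>y\<rfloor>}"
    using assms by (auto simp: le_nat_iff le_floor_iff floor_le_iff)
  then have "(\<Sum>k=1..n. if real k \<le> y then 1 else 0 :: real) = real (nat \<lfloor>y\<rfloor>)"
    by (simp flip: sum.inter_filter)
  moreover have "real (nat \<lfloor>y\<rfloor>) = of_int \<lfloor>y\<rfloor>" using assms by simp
  ultimately show "(\<Sum>k=1..n. if real k \<le> y then 1 else 0 :: real) \<le> y"
    "y \<le> (\<Sum>k=1..n. if real k \<le> y then 1 else 0 :: real) + 1"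
    by linarith+
qed

text \<open>A discrete layer-cake formula: integrating the level count shows that \<open>n * \<integral>g\<close> is,
  up to an error of \<open>1\<close>, the sum of the measures of the sets \<open>{x. k / n \<le> g x}\<close>.\<close>

lemma integral_level_sum_bounds:
  fixes g :: "'a \<Rightarrow> real"
  assumes "prob_space M" and g: "g \<in> borel_measurable M"
    and rg: "\<And>x. 0 \<le> g x" "\<And>x. g x \<le> 1"
  shows "(\<Sum>k=1..n. measure M {x\<in>space M. real k \<le> real n * g x}) \<le> real n * (\<integral>x. g x \<partial>M)"
    and "real n * (\<integral>x. g x \<partial>M) \<le> (\<Sum>k=1..n. measure M {x\<in>space M. real k \<le> real n * g x}) + 1"
proof -
  interpret prob_space M by fact
  define L where "L k = {x\<in>space M. real k \<le> real n * g x}" for k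
  have mL [measurable]: "L k \<in> sets M" for k
    unfolding L_def using g by measurable
  define h where "h x = (\<Sum>k=1..n. indicator (L k) x :: real)" for x
  have h_eq: "h x = (\<Sum>k=1..n. if real k \<le> real n * g x then 1 else 0)" if "x \<in> space M" for x
    unfolding h_def L_def using that by (intro sum.cong) (auto simp: indicator_def)
  have ng: "0 \<le> real n * g x" "real n * g x \<le> real n" for x
    using rg[of x] by (auto intro: mult_left_le)
  have int_g: "integrable M (\<lambda>x. real n * g x)"
    using g rg by (intro integrable_mult_right integrable_const_bound[of _ 1]) auto
  have int_ind: "integrable M (indicator (L k) :: 'a \<Rightarrow> real)" for k
    by (simp add: integrable_indicator_iff emeasure_eq_measure)
  have int_h: "integrable M h"
    unfolding h_def using int_ind by (intro Bochner_Integration.integrable_sum)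
  have h_int: "(\<integral>x. h x \<partial>M) = (\<Sum>k=1..n. measure M (L k))"
    unfolding h_def using int_ind mL
    by (subst Bochner_Integration.integral_sum) auto
  have "(\<integral>x. h x \<partial>M) \<le> (\<integral>x. real n * g x \<partial>M)"
    using int_h int_g by (rule integral_mono) (use h_eq sum_levels_bounds(1)[OF ng] in simp)
  then show "(\<Sum>k=1..n. measure M {x\<in>space M. real k \<le> real n * g x}) \<le> real n * (\<integral>x. g x \<partial>M)"
    by (simp add: h_int L_def)
  have "(\<integral>x. real n * g x \<partial>M) \<le> (\<integral>x. h x + 1 \<partial>M)"
    using int_g by (rule integral_mono)
      (use int_h h_eq sum_levels_bounds(2)[OF ng] in auto)
  also have "\<dots> = (\<integral>x. h x \<partial>M) + 1"
    using int_h by (simp add: prob_space)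
  finally show "real n * (\<integral>x. g x \<partial>M) \<le> (\<Sum>k=1..n. measure M {x\<in>space M. real k \<le> real n * g x}) + 1"
    by (simp add: h_int L_def)
qed

lemma integral_diff_le_if_borel_bound:
  fixes g :: "'a \<Rightarrow> real"
  assumes P: "prob_space P" and Q: "prob_space Q" and sets: "sets Q = sets P"
    and bound: "\<And>A. A \<in> sets P \<Longrightarrow> measure P A - measure Q A \<le> d"
    and g: "g \<in> borel_measurable P" and rg: "\<And>x. 0 \<le> g x" "\<And>x. g x \<le> 1"
  shows "(\<integral>x. g x \<partial>P) - (\<integral>x. g x \<partial>Q) \<le> d"
proof (rule field_le_epsilon)
  fix e :: real assume "e > 0"
  then obtain m where m: "inverse (real (Suc m)) < e"
    using reals_Archimedean by blast
  define n where "n = Suc m"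
  have n: "1 < real n * e"
    using m by (simp add: n_def field_simps)
  have gQ: "g \<in> borel_measurable Q"
    using g by (simp add: measurable_cong_sets[OF sets refl])
  have sp: "space Q = space P" using sets by (rule sets_eq_imp_space_eq)
  define L where "L k = {x\<in>space P. real k \<le> real n * g x}" for k
  have mL: "L k \<in> sets P" for k
    unfolding L_def using g by measurable
  have "real n * ((\<integral>x. g x \<partial>P) - (\<integral>x. g x \<partial>Q))
      \<le> (\<Sum>k=1..n. measure P (L k)) + 1 - (\<Sum>k=1..n. measure Q (L k))"
    using integral_level_sum_bounds(2)[OF P g rg, of n]
      integral_level_sum_bounds(1)[OF Q gQ rg, of n]
    by (simp add: L_def sp right_diff_distrib)
  also have "\<dots> = (\<Sum>k=1..n. measure P (L k) - measure Q (L k)) + 1"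
    by (simp add: sum_subtractf)
  also have "\<dots> \<le> (\<Sum>k=1..n. d) + 1"
    using bound mL by (intro add_mono sum_mono) auto
  also have "\<dots> \<le> real n * (d + e)"
    using n by (simp add: distrib_left)
  finally show "(\<integral>x. g x \<partial>P) - (\<integral>x. g x \<partial>Q) \<le> d + e"
    by (simp add: n_def)
qed

text \<open>The affine map \<open>y \<mapsto> (y + 1) / 2\<close> takes \<open>[-1, 1]\<close> to \<open>[0, 1]\<close> and halves the difference
  of the two integrals; this is the source of the factor \<open>2\<close>.\<close>

lemma function_bound_if_closed_bound:
  fixes P Q :: "'a::metric_space measure"
  assumes P: "prob_space P" "sets P = sets borel"
    and Q: "prob_space Q" "sets Q = sets borel"
    and bound: "\<And>C. closed C \<Longrightarrow> measure P C - measure Q C \<le> d"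
    and f: "f \<in> borel_measurable borel" "f \<in> UNIV \<rightarrow> {-1..1::real}"
  shows "(\<integral>x. f x \<partial>P) - (\<integral>x. f x \<partial>Q) \<le> 2 * d"
proof -
  interpret P: prob_space P by fact
  interpret Q: prob_space Q by fact
  have rg: "- 1 \<le> f x" "f x \<le> 1" for x using f(2) by auto
  have fP: "f \<in> borel_measurable P" and fQ: "f \<in> borel_measurable Q"
    using f(1) by (simp_all add: measurable_cong_sets[OF P(2) refl] measurable_cong_sets[OF Q(2) refl])
  have int: "integrable P f" "integrable Q f"
    using fP fQ rg by (auto intro!: P.integrable_const_bound[of _ 1]
        Q.integrable_const_bound[of _ 1] simp: abs_le_iff minus_le_iff)
  have "(\<integral>x. (f x + 1) / 2 \<partial>P) - (\<integral>x. (f x + 1) / 2 \<partial>Q) \<le> d"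
  proof (rule integral_diff_le_if_borel_bound[OF P(1) Q(1)])
    show "measure P A - measure Q A \<le> d" if "A \<in> sets P" for A
      using borel_bound_if_closed_bound[OF P.finite_measure_axioms P(2) Q.finite_measure_axioms Q(2)
          bound] that by (simp add: P)
    show "0 \<le> (f x + 1) / 2" "(f x + 1) / 2 \<le> 1" for x using rg[of x] by auto
  qed (use P Q fP in auto)
  then show ?thesis
    using int by (simp add: P.prob_space Q.prob_space field_simps)
qed

lemma abs_function_bound_if_closed_bound:
  fixes P Q :: "'a::metric_space measure"
  assumes P: "prob_space P" "sets P = sets borel"
    and Q: "prob_space Q" "sets Q = sets borel"
    and bound: "\<And>C. closed C \<Longrightarrow> measure P C - measure Q C \<le> d"
    and f: "f \<in> borel_measurable borel" "f \<in> UNIV \<rightarrow> {-1..1::real}"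
  shows "\<bar>(\<integral>x. f x \<partial>P) - (\<integral>x. f x \<partial>Q)\<bar> \<le> 2 * d"
proof -
  have "(\<lambda>x. - f x) \<in> UNIV \<rightarrow> {-1..1}"
    using f(2) by (auto simp: Pi_iff minus_le_iff)
  then show ?thesis
    using function_bound_if_closed_bound[OF P Q bound f]
      function_bound_if_closed_bound[OF P Q bound, of "\<lambda>x. - f x"] f(1)
    by (simp add: abs_le_iff)
qed

lemma abs_function_bound_if_open_bound:
  fixes P Q :: "'a::metric_space measure"
  assumes P: "prob_space P" "sets P = sets borel"
    and Q: "prob_space Q" "sets Q = sets borel"
    and bound: "\<And>U. open U \<Longrightarrow> measure P U - measure Q U \<le> d"
    and f: "f \<in> borel_measurable borel" "f \<in> UNIV \<rightarrow> {-1..1::real}"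
  shows "\<bar>(\<integral>x. f x \<partial>P) - (\<integral>x. f x \<partial>Q)\<bar> \<le> 2 * d"
proof -
  have "measure Q C - measure P C \<le> d" if "closed C" for C
  proof -
    have "measure P (space P - C) = 1 - measure P C" "measure Q (space Q - C) = 1 - measure Q C"
      using that by (auto intro!: prob_space.prob_compl P Q simp: P Q)
    moreover have "space P - C = - C" "space Q - C = - C"
      using sets_eq_imp_space_eq[OF P(2)] sets_eq_imp_space_eq[OF Q(2)] by auto
    ultimately show ?thesis
      using bound[of "- C"] that by (simp add: open_Compl)
  qed
  from abs_function_bound_if_closed_bound[OF Q P this f] show ?thesis
    by (simp add: abs_minus_commute)
qed

text \<open>The continuous functions \<open>2 * max 0 (1 - n * infdist x C) - 1\<close> decrease to \<open>1\<close> on \<open>C\<close> and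
  \<open>- 1\<close> off \<open>C\<close>.\<close>

lemma closed_bound_if_continuous_bound:
  fixes P Q :: "'a::metric_space measure"
  assumes P: "prob_space P" "sets P = sets borel"
    and Q: "prob_space Q" "sets Q = sets borel"
    and bound: "\<And>f :: 'a \<Rightarrow> real. continuous_on UNIV f \<Longrightarrow> f \<in> UNIV \<rightarrow> {-1..1} \<Longrightarrow>
      (\<integral>x. f x \<partial>P) - (\<integral>x. f x \<partial>Q) \<le> 2 * d"
    and C: "closed C"
  shows "measure P C - measure Q C \<le> d"
proof (cases "C = {}")
  case True
  \<comment> \<open>treated apart because \<open>infdist x {} = 0\<close>\<close>
  then show ?thesis using bound[of "\<lambda>_. 0"] by simp
next
  case False
  define f where "f n x = 2 * max 0 (1 - real n * infdist x C) - 1" for n x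
  have cont: "continuous_on UNIV (f n)" for n
    unfolding f_def by (intro continuous_intros)
  have rg: "f n \<in> UNIV \<rightarrow> {-1..1}" for n
    by (auto simp: f_def infdist_nonneg)
  have lim: "(\<lambda>n. f n x) \<longlonglongrightarrow> 2 * indicator C x - 1" for x
  proof (cases "x \<in> C")
    case True
    then show ?thesis by (simp add: f_def)
  next
    case off: False
    then have pos: "infdist x C > 0"
      using in_closed_iff_infdist_zero[OF C False, of x] infdist_nonneg[of x C] by auto
    obtain N where N: "1 < real N * infdist x C"
      using reals_Archimedean3[OF pos] by blast
    have "f n x = - 1" if "N \<le> n" for n
    proof -
      have "real N * infdist x C \<le> real n * infdist x C"
        using that pos by (intro mult_right_mono) auto
      then show ?thesis using N by (simp add: f_def)
    qed
    then show ?thesis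
      using off by (intro tendsto_eventually eventually_sequentiallyI[of N]) simp
  qed
  have int_lim: "(\<lambda>n. \<integral>x. f n x \<partial>M) \<longlonglongrightarrow> 2 * measure M C - 1"
    if M: "prob_space M" "sets M = sets borel" for M :: "'a measure"
  proof -
    interpret prob_space M by fact
    have mC [measurable]: "C \<in> sets M" using C by (simp add: M)
    have mf: "f n \<in> borel_measurable M" for n
      using borel_measurable_continuous_onI[OF cont] by (simp add: measurable_cong_sets[OF M(2) refl])
    have "(\<lambda>n. \<integral>x. f n x \<partial>M) \<longlonglongrightarrow> (\<integral>x. 2 * indicator C x - 1 \<partial>M)"
      using mf lim rg
      by (intro integral_dominated_convergence[where w="\<lambda>_. 1"])
        (auto simp: abs_le_iff Pi_iff minus_le_iff)
    also have "(\<integral>x. 2 * indicator C x - 1 \<partial>M) = 2 * measure M C - 1"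
      using mC by (subst Bochner_Integration.integral_diff)
        (auto simp: prob_space integrable_indicator_iff emeasure_eq_measure)
    finally show ?thesis .
  qed
  have "(\<lambda>n. (\<integral>x. f n x \<partial>P) - (\<integral>x. f n x \<partial>Q)) \<longlonglongrightarrow> (2 * measure P C - 1) - (2 * measure Q C - 1)"
    by (intro tendsto_diff int_lim P Q)
  then have "(2 * measure P C - 1) - (2 * measure Q C - 1) \<le> 2 * d"
    using bound[OF cont rg] by (intro LIMSEQ_le_const2) auto
  then show ?thesis by simp
qed

text \<open>The function taking the value \<open>1\<close> on \<open>A\<close> and \<open>- 1\<close> off \<open>A\<close> attains the factor \<open>2\<close>.\<close>

lemma abs_measure_bound_if_function_bound:
  fixes P Q :: "'a::topological_space measure"
  assumes P: "prob_space P" "sets P = sets borel"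
    and Q: "prob_space Q" "sets Q = sets borel"
    and bound: "\<And>f :: 'a \<Rightarrow> real. f \<in> borel_measurable borel \<Longrightarrow> f \<in> UNIV \<rightarrow> {-1..1} \<Longrightarrow>
      \<bar>(\<integral>x. f x \<partial>P) - (\<integral>x. f x \<partial>Q)\<bar> \<le> 2 * d"
    and A: "A \<in> sets borel"
  shows "\<bar>measure P A - measure Q A\<bar> \<le> d"
proof -
  have int: "(\<integral>x. 2 * indicator A x - 1 \<partial>M) = 2 * measure M A - 1"
    if M: "prob_space M" "sets M = sets borel" for M :: "'a measure"
  proof -
    interpret prob_space M by fact
    have "A \<in> sets M" using A by (simp add: M)
    then show ?thesis
      by (subst Bochner_Integration.integral_diff)
        (auto simp: prob_space integrable_indicator_iff emeasure_eq_measure)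
  qed
  have "\<bar>(\<integral>x. 2 * indicator A x - 1 \<partial>P) - (\<integral>x. 2 * indicator A x - 1 \<partial>Q)\<bar> \<le> 2 * d"
    using A by (intro bound) (auto simp: indicator_def)
  then show ?thesis by (simp add: int P Q)
qed

section \<open>Comparison of the suprema\<close>

text \<open>On the reals \<open>Sup\<close> is the least upper bound whenever one exists, and otherwise still depends on
  nothing but the upper bounds.\<close>

lemma Sup_eq_if_same_upper_bounds:
  fixes S T :: "real set"
  assumes "\<And>d. (\<forall>x\<in>S. x \<le> d) \<longleftrightarrow> (\<forall>x\<in>T. x \<le> d)"
  shows "Sup S = Sup T"
  unfolding Sup_real_def using assms by simp

lemma Sup_eq_twice_Sup_if_double_upper_bounds:
  fixes S T :: "real set"
  assumes ub: "\<And>d. (\<forall>x\<in>S. x \<le> 2 * d) \<longleftrightarrow> (\<forall>y\<in>T. y \<le> d)"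
    and S: "S \<noteq> {}" "bdd_above S" and T: "T \<noteq> {}"
  shows "Sup S = 2 * Sup T"
proof (rule antisym)
  obtain b where "\<forall>x\<in>S. x \<le> 2 * (b / 2)" using S(2) by (auto simp: bdd_above_def)
  then have "\<forall>y\<in>T. y \<le> b / 2" using ub by blast
  then have "bdd_above T" unfolding bdd_above_def by blast
  then have "\<forall>y\<in>T. y \<le> Sup T" by (auto intro: cSup_upper)
  then have "\<forall>x\<in>S. x \<le> 2 * Sup T" using ub by blast
  then show "Sup S \<le> 2 * Sup T" using S(1) by (auto intro: cSup_least)
  have "\<forall>x\<in>S. x \<le> 2 * (Sup S / 2)" using S(2) by (auto intro: cSup_upper)
  then have "\<forall>y\<in>T. y \<le> Sup S / 2" using ub by blast
  then have "Sup T \<le> Sup S / 2" using T by (intro cSup_least) blast+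
  then show "2 * Sup T \<le> Sup S" by simp
qed

theorem theorem2p5:
  fixes P Q :: "'a::metric_space measure"
  assumes "prob_space P" and "sets P = sets borel"
    and "prob_space Q" and "sets Q = sets borel"
  shows
    "(rho_tv P Q = 2 * Sup {\<bar>measure P C - measure Q C\<bar> | C. closed C} \<and>
      2 * Sup {\<bar>measure P C - measure Q C\<bar> | C. closed C} =
      2 * Sup {measure P C - measure Q C | C. closed C}) \<and>
     (rho_tv P Q = 2 * Sup {\<bar>measure P U - measure Q U\<bar> | U. open U} \<and>
      2 * Sup {\<bar>measure P U - measure Q U\<bar> | U. open U} =
      2 * Sup {measure P U - measure Q U | U. open U}) \<and>
     rho_tv P Q = Sup {(\<integral>s. f s \<partial>P) - (\<integral>s. f s \<partial>Q) | f :: 'a \<Rightarrow> real.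
       continuous_on UNIV f \<and> f \<in> UNIV \<rightarrow> {-1..1}} \<and>
     rho_tv P Q = Sup {\<bar>(\<integral>s. f s \<partial>P) - (\<integral>s. f s \<partial>Q)\<bar> | f :: 'a \<Rightarrow> real.
       continuous_on UNIV f \<and> f \<in> UNIV \<rightarrow> {-1..1}}"
proof -
  define F where "F = {\<bar>(\<integral>s. f s \<partial>P) - (\<integral>s. f s \<partial>Q)\<bar> | f :: 'a \<Rightarrow> real.
     f \<in> borel_measurable borel \<and> f \<in> UNIV \<rightarrow> {-1..1}}"
  have rho: "rho_tv P Q = Sup F" by (simp add: F_def rho_tv_def)
  have F_iff: "(\<forall>x\<in>F. x \<le> d) \<longleftrightarrow> (\<forall>f :: 'a \<Rightarrow> real. f \<in> borel_measurable borel \<longrightarrow>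
      f \<in> UNIV \<rightarrow> {-1..1} \<longrightarrow> \<bar>(\<integral>s. f s \<partial>P) - (\<integral>s. f s \<partial>Q)\<bar> \<le> d)" for d
    unfolding F_def by blast
  have F_ne: "F \<noteq> {}"
  proof -
    have "(\<lambda>_. 0 :: real) \<in> borel_measurable borel" "(\<lambda>_::'a. 0 :: real) \<in> UNIV \<rightarrow> {-1..1}" by auto
    then show ?thesis unfolding F_def by blast
  qed
  have F_if_closed: "\<forall>x\<in>F. x \<le> 2 * d" if "\<And>C. closed C \<Longrightarrow> measure P C - measure Q C \<le> d" for d
    unfolding F_iff using abs_function_bound_if_closed_bound[OF assms that] by blast
  have F_if_open: "\<forall>x\<in>F. x \<le> 2 * d" if "\<And>U. open U \<Longrightarrow> measure P U - measure Q U \<le> d" for d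
    unfolding F_iff using abs_function_bound_if_open_bound[OF assms that] by blast
  have F_if_cont: "\<forall>x\<in>F. x \<le> d" if "\<And>f :: 'a \<Rightarrow> real. continuous_on UNIV f \<Longrightarrow>
      f \<in> UNIV \<rightarrow> {-1..1} \<Longrightarrow> (\<integral>s. f s \<partial>P) - (\<integral>s. f s \<partial>Q) \<le> d" for d
    using F_if_closed[of "d / 2"] closed_bound_if_continuous_bound[OF assms, of "d / 2"] that
    by simp
  have sets_if_F: "\<bar>measure P A - measure Q A\<bar> \<le> d" if "\<forall>x\<in>F. x \<le> 2 * d" "A \<in> sets borel" for d A
    using abs_measure_bound_if_function_bound[OF assms, of d A] that unfolding F_iff by blast
  have cont_if_F: "\<bar>(\<integral>s. f s \<partial>P) - (\<integral>s. f s \<partial>Q)\<bar> \<le> d"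
    if "\<forall>x\<in>F. x \<le> d" "continuous_on UNIV f" "f \<in> UNIV \<rightarrow> {-1..1}" for d and f :: "'a \<Rightarrow> real"
    using that borel_measurable_continuous_onI[of f] unfolding F_iff by blast
  have "measure P C - measure Q C \<le> 1" for C
    using prob_space.prob_le_1[OF assms(1), of C] measure_nonneg[of Q C] by linarith
  then have F_bdd: "bdd_above F"
    using F_if_closed[of 1] by (auto simp: bdd_above_def)
  note twice = Sup_eq_twice_Sup_if_double_upper_bounds[OF _ F_ne F_bdd]
  have closed_abs: "Sup F = 2 * Sup {\<bar>measure P C - measure Q C\<bar> | C. closed C}"
  proof (rule twice)
    show "(\<forall>x\<in>F. x \<le> 2 * d) \<longleftrightarrow> (\<forall>y\<in>{\<bar>measure P C - measure Q C\<bar> | C. closed C}. y \<le> d)" for d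
      using sets_if_F[of d] F_if_closed[of d] by (fastforce simp: abs_le_iff)
  qed (use closed_UNIV in blast)
  have closed: "Sup F = 2 * Sup {measure P C - measure Q C | C. closed C}"
  proof (rule twice)
    show "(\<forall>x\<in>F. x \<le> 2 * d) \<longleftrightarrow> (\<forall>y\<in>{measure P C - measure Q C | C. closed C}. y \<le> d)" for d
      using sets_if_F[of d] F_if_closed[of d] by (fastforce simp: abs_le_iff)
  qed (use closed_UNIV in blast)
  have open_abs: "Sup F = 2 * Sup {\<bar>measure P U - measure Q U\<bar> | U. open U}"
  proof (rule twice)
    show "(\<forall>x\<in>F. x \<le> 2 * d) \<longleftrightarrow> (\<forall>y\<in>{\<bar>measure P U - measure Q U\<bar> | U. open U}. y \<le> d)" for d
      using sets_if_F[of d] F_if_open[of d] by (fastforce simp: abs_le_iff)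
  qed (use open_UNIV in blast)
  have open_signed: "Sup F = 2 * Sup {measure P U - measure Q U | U. open U}"
  proof (rule twice)
    show "(\<forall>x\<in>F. x \<le> 2 * d) \<longleftrightarrow> (\<forall>y\<in>{measure P U - measure Q U | U. open U}. y \<le> d)" for d
      using sets_if_F[of d] F_if_open[of d] by (fastforce simp: abs_le_iff)
  qed (use open_UNIV in blast)
  have cont: "Sup F = Sup {(\<integral>s. f s \<partial>P) - (\<integral>s. f s \<partial>Q) | f :: 'a \<Rightarrow> real.
       continuous_on UNIV f \<and> f \<in> UNIV \<rightarrow> {-1..1}}" (is "_ = Sup ?G")
  proof (rule Sup_eq_if_same_upper_bounds)
    show "(\<forall>x\<in>F. x \<le> d) \<longleftrightarrow> (\<forall>x\<in>?G. x \<le> d)" for d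
    proof
      show "\<forall>x\<in>?G. x \<le> d" if "\<forall>x\<in>F. x \<le> d"
        using cont_if_F[OF that] by (auto simp: abs_le_iff)
      show "\<forall>x\<in>F. x \<le> d" if "\<forall>x\<in>?G. x \<le> d"
        using that by (intro F_if_cont) blast
    qed
  qed
  have cont_abs: "Sup F = Sup {\<bar>(\<integral>s. f s \<partial>P) - (\<integral>s. f s \<partial>Q)\<bar> | f :: 'a \<Rightarrow> real.
       continuous_on UNIV f \<and> f \<in> UNIV \<rightarrow> {-1..1}}" (is "_ = Sup ?H")
  proof (rule Sup_eq_if_same_upper_bounds)
    show "(\<forall>x\<in>F. x \<le> d) \<longleftrightarrow> (\<forall>x\<in>?H. x \<le> d)" for d
    proof
      show "\<forall>x\<in>?H. x \<le> d" if "\<forall>x\<in>F. x \<le> d"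
        using cont_if_F[OF that] by auto
      show "\<forall>x\<in>F. x \<le> d" if H: "\<forall>x\<in>?H. x \<le> d"
      proof (rule F_if_cont)
        fix f :: "'a \<Rightarrow> real"
        assume "continuous_on UNIV f" "f \<in> UNIV \<rightarrow> {-1..1}"
        then have "\<bar>(\<integral>s. f s \<partial>P) - (\<integral>s. f s \<partial>Q)\<bar> \<le> d" using H by blast
        then show "(\<integral>s. f s \<partial>P) - (\<integral>s. f s \<partial>Q) \<le> d" by simp
      qed
    qed
  qed
  show ?thesis
    unfolding rho using closed_abs closed open_abs open_signed cont cont_abs by (intro conjI) simp_all
qed

end
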